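(* Let $\mathcal{T}_{\mathrm{Sch}}$ be the generating tree of the succession rule (NewSch): the root is labelled $(1,1)$, and a vertex labelled $(h,k)$ has children with labels $$(1,k+1),(2,k+1),\ldots,(h,k+1),\ (2,1),(2,2),\ldots,(2,k-1),\ (h+1,k).$$ For $n\ge1$, let $c_n$ be the number of vertices of $\mathcal{T}_{\mathrm{Sch}}$ at depth $n$. Then $(c_n)_{n\ge1}$ is the sequence of large Schröder numbers, that is, $$\sum_{n\ge1}c_nx^{n-1}=\frac{1-x-\sqrt{1-6x+x^2}}{2x}.$$ In particular, $c_1,c_2,\ldots=1,2,6,22,90,\ldots$.
   Context: A succession rule consists of a root label and, for each label, a list (with multiplicities) of the labels of its children. It determines an infinite rooted labelled tree: the root, at depth $1$, carries the root label, and every vertex with label $\lambda$ has one child for each label in the production of $\lambda$. The enumeration sequence of the rule is the sequence of the numbers of vertices at each depth. *)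

theory Defs
  imports Complex_Main "HOL-Computational_Algebra.Formal_Power_Series"
begin

type_synonym 'a succession_rule = "'a \<times> ('a \<Rightarrow> 'a list)"

text \<open>
  The vertices of the generating tree of a rule, together with their labels. A vertex is
  represented by its address: the list of child indices (counted from 0) along the path from the
  root. Thus children carrying equal labels are still distinct vertices.
\<close>
inductive_set tree_vertices :: "'a succession_rule \<Rightarrow> (nat list \<times> 'a) set"
  for R :: "'a succession_rule" where
  root: "([], fst R) \<in> tree_vertices R"
| child: "(v, l) \<in> tree_vertices R \<Longrightarrow> i < length (snd R l)
    \<Longrightarrow> (v @ [i], snd R l ! i) \<in> tree_vertices R"

text \<open>The root has depth 1.\<close>
definition vertices_at_depth :: "'a succession_rule \<Rightarrow> nat \<Rightarrow> (nat list \<times> 'a) set" where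
  "vertices_at_depth R n = {(v, l) \<in> tree_vertices R. length v + 1 = n}"

text \<open>Productions are finite lists, so every level is finite and the cardinality is meaningful.\<close>
definition enumeration_seq :: "'a succession_rule \<Rightarrow> nat \<Rightarrow> nat" where
  "enumeration_seq R n = card (vertices_at_depth R n)"

fun NewSch_production :: "nat \<times> nat \<Rightarrow> (nat \<times> nat) list" where
  "NewSch_production (h, k) =
     map (\<lambda>i. (i, k + 1)) [1..<h + 1] @ map (\<lambda>j. (2, j)) [1..<k] @ [(h + 1, k)]"

definition NewSch :: "(nat \<times> nat) succession_rule" where
  "NewSch = ((1, 1), NewSch_production)"

text \<open>
  In the ring of formal power series, division by \<open>2 * fps_X\<close> is a shift (and a halving) that
  discards the constant coefficient of the numerator. Here this coefficient is 0, so the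
  quotient is exact: \<open>fps_radical root 2\<close> is the square root whose constant coefficient is the
  nonnegative root of that of its argument.
\<close>
definition large_Schroeder_gf :: "real fps" where
  "large_Schroeder_gf =
     (1 - fps_X - fps_radical root 2 (1 - 6 * fps_X + fps_X ^ 2)) / (2 * fps_X)"

end

theory Submission
  imports Defs
begin

unbundle fps_syntax

text \<open>
  The labels of the children of \<open>(h, k)\<close> have the coordinate sums \<open>3, \<dots>, s + 1, s + 1\<close>,
  where \<open>s = h + k\<close>. So the number of descendants depends only on \<open>s\<close>. The generating functions
  \<open>G s\<close> by relative depth are determined by \<open>G s = 1 + x (G 3 + \<dots> + G (s + 1) + G (s + 1))\<close>,
  which is solved by \<open>G s = S a ^ (s - 2)\<close>, where \<open>S = 1 + x S + x S\<^sup>2\<close> is the large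
  Schroeder series and \<open>a = (1 + S) / 2\<close> the little one.
\<close>

text \<open>Counts the vertices \<open>n\<close> levels below a vertex labelled \<open>l\<close>.
  The recursion branches at the top vertex, whereas \<open>tree_vertices\<close> grows at the
  leaves.\<close>

primrec num_descendants :: "'a succession_rule \<Rightarrow> nat \<Rightarrow> 'a \<Rightarrow> nat" where
  "num_descendants R 0 l = 1"
| "num_descendants R (Suc n) l = sum_list (map (num_descendants R n) (snd R l))"

lemma tree_vertices_Nil_iff: "([], l) \<in> tree_vertices R \<longleftrightarrow> l = fst R"
  by (subst tree_vertices.simps) auto

lemma tree_vertices_snoc_iff:
  "(v @ [i], l') \<in> tree_vertices R \<longleftrightarrow>
     (\<exists>l. (v, l) \<in> tree_vertices R \<and> i < length (snd R l) \<and> l' = snd R l ! i)"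
  by (subst tree_vertices.simps) auto

lemma tree_vertices_label_unique:
  "(v, l) \<in> tree_vertices R \<Longrightarrow> (v, l') \<in> tree_vertices R \<Longrightarrow> l = l'"
proof (induction v arbitrary: l l' rule: rev_induct)
  case Nil
  then show ?case by (simp add: tree_vertices_Nil_iff)
next
  case (snoc i v)
  then show ?case unfolding tree_vertices_snoc_iff by blast
qed

lemma vertices_at_depth_1: "vertices_at_depth R (Suc 0) = {([], fst R)}"
  by (auto simp: vertices_at_depth_def tree_vertices_Nil_iff)

lemma vertices_at_depth_Suc_Suc:
  "vertices_at_depth R (Suc (Suc n)) =
     (\<lambda>((v, l), i). (v @ [i], snd R l ! i)) `
       (SIGMA p:vertices_at_depth R (Suc n). {..<length (snd R (snd p))})"
  (is "?A = ?f ` ?B")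
proof
  show "?A \<subseteq> ?f ` ?B"
  proof
    fix p assume p: "p \<in> ?A"
    obtain w l' where pw: "p = (w, l')" by (cases p)
    with p have w: "(w, l') \<in> tree_vertices R" "length w = Suc n"
      by (auto simp: vertices_at_depth_def)
    then obtain v i where vi: "w = v @ [i]" by (cases w rule: rev_cases) auto
    with w obtain l where l: "(v, l) \<in> tree_vertices R" "i < length (snd R l)" "l' = snd R l ! i"
      by (auto simp: tree_vertices_snoc_iff)
    then have "((v, l), i) \<in> ?B" using w vi by (auto simp: vertices_at_depth_def)
    moreover have "p = ?f ((v, l), i)" using pw vi l by simp
    ultimately show "p \<in> ?f ` ?B" by blast
  qed
  show "?f ` ?B \<subseteq> ?A"
    by (auto simp: vertices_at_depth_def intro: tree_vertices.child)
qed

lemma finite_vertices_at_depth: "finite (vertices_at_depth R (Suc n))"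
  by (induction n) (auto simp: vertices_at_depth_1 vertices_at_depth_Suc_Suc)

lemma sum_vertices_at_depth_Suc_Suc:
  fixes g :: "'a \<Rightarrow> nat"
  shows "(\<Sum>p\<in>vertices_at_depth R (Suc (Suc n)). g (snd p)) =
    (\<Sum>p\<in>vertices_at_depth R (Suc n). sum_list (map g (snd R (snd p))))"
proof -
  let ?B = "SIGMA p:vertices_at_depth R (Suc n). {..<length (snd R (snd p))}"
  let ?f = "\<lambda>((v, l), i). (v @ [i], snd R l ! i)"
  \<comment> \<open>The address \<open>v @ [i]\<close> gives back \<open>v\<close> and
    \<open>i\<close>, and \<open>v\<close> determines its label.\<close>
  have inj: "inj_on ?f ?B"
    by (rule inj_onI)
      (auto simp: vertices_at_depth_def dest: tree_vertices_label_unique)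
  have "(\<Sum>p\<in>vertices_at_depth R (Suc (Suc n)). g (snd p)) = (\<Sum>q\<in>?B. g (snd (?f q)))"
    unfolding vertices_at_depth_Suc_Suc by (subst sum.reindex[OF inj]) simp
  also have "\<dots> = (\<Sum>q\<in>?B. case q of (p, i) \<Rightarrow> g (snd R (snd p) ! i))"
    by (rule sum.cong) auto
  also have "\<dots> = (\<Sum>p\<in>vertices_at_depth R (Suc n). \<Sum>i<length (snd R (snd p)). g (snd R (snd p) ! i))"
    by (rule sum.Sigma[symmetric]) (auto simp: finite_vertices_at_depth)
  also have "\<dots> = (\<Sum>p\<in>vertices_at_depth R (Suc n). sum_list (map g (snd R (snd p))))"
    by (simp add: sum_list_sum_nth atLeast0LessThan)
  finally show ?thesis .
qed

text \<open>Each induction step trades one level of descendants for one level of depth, so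
  \<open>m\<close> must vary. For \<open>m = 0\<close> only the root is summed over.\<close>

lemma enumeration_seq_add:
  "enumeration_seq R (Suc (m + n)) =
     (\<Sum>p\<in>vertices_at_depth R (Suc m). num_descendants R n (snd p))"
proof (induction n arbitrary: m)
  case 0
  then show ?case by (simp add: enumeration_seq_def)
next
  case (Suc n)
  from Suc[of "Suc m"] show ?case by (simp add: sum_vertices_at_depth_Suc_Suc)
qed

lemma enumeration_seq_Suc: "enumeration_seq R (Suc n) = num_descendants R n (fst R)"
  using enumeration_seq_add[of R 0 n] by (simp add: vertices_at_depth_1)

lemma large_Schroeder_gf_eq:
  defines "S \<equiv> large_Schroeder_gf"
  shows "S = 1 + fps_X * S + fps_X * S ^ 2"
proof -
  define D where "D = (1 - 6 * fps_X + fps_X ^ 2 :: real fps)"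
  define r where "r = fps_radical root 2 D"
  have D0: "D $ 0 = 1" by (simp add: D_def)
  have r2: "r ^ 2 = D"
    using power_radical[of D root 1] D0 by (simp add: r_def numeral_2_eq_2)
  have r0: "r $ 0 = 1" using D0 by (simp add: r_def)
  \<comment> \<open>The constant coefficient of the numerator vanishes by \<open>r0\<close>, so the
    shift loses nothing.\<close>
  have "1 - fps_X - r = fps_X * fps_shift 1 (1 - fps_X - r)"
    by (rule fps_ext) (simp add: r0)
  then obtain q where q: "1 - fps_X - r = fps_X * q" by blast
  have two: "fps_const (1 / 2) * 2 = (1 :: real fps)"
    by (simp add: fps_numeral_fps_const)
  have "1 - fps_X - r = (fps_const (1 / 2) * q) * (2 * fps_X)"
    using q two by algebra
  moreover have "S = (1 - fps_X - r) / (2 * fps_X)"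
    by (simp add: S_def large_Schroeder_gf_def r_def D_def)
  ultimately have "2 * fps_X * S = 1 - fps_X - r" by simp
  then have "r = 1 - fps_X - 2 * fps_X * S" by simp
  with r2 have "(1 - fps_X - 2 * fps_X * S) ^ 2 = 1 - 6 * fps_X + fps_X ^ 2"
    by (simp add: D_def)
  \<comment> \<open>Expanding the square reverses the quadratic formula, up to the factor
    \<open>4 * fps_X\<close>.\<close>
  then have "(4 * fps_X) * S = (4 * fps_X) * (1 + fps_X * S + fps_X * S ^ 2)"
    by (simp add: algebra_simps power2_eq_square)
  then show ?thesis by (subst (asm) mult_left_cancel) simp_all
qed

text \<open>From \<open>m\<close> to \<open>m + 1\<close> both sides grow by
  \<open>x * S ^ 2 * a ^ (m + 1)\<close>: the left because \<open>a - 1 = x * S * a\<close>, the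
  right because \<open>2 * a - 1 = S\<close>.\<close>

lemma sum_telescope_Schroeder:
  fixes S a x :: "'a :: comm_ring_1"
  assumes S: "S = 1 + x * S + x * S ^ 2" and a: "2 * a = 1 + S" "a - 1 = x * S * a"
  shows "S * a ^ m = 1 + x * ((\<Sum>i=1..m + 1. S * a ^ i) + S * a ^ (m + 1))"
proof (induction m)
  case 0
  have "S = 1 + x * (S * (1 + S))" using S by (simp add: algebra_simps power2_eq_square)
  then show ?case by (simp add: algebra_simps flip: a(1))
next
  case (Suc m)
  define T where "T = (\<Sum>i=1..m + 1. S * a ^ i)"
  have IH: "S * a ^ m = 1 + x * (T + S * (a * a ^ m))"
    using Suc by (simp add: T_def)
  have "S * (a * a ^ m) = S * a ^ m + (a - 1) * (S * a ^ m)"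
    by (simp add: algebra_simps)
  also have "\<dots> = 1 + x * (T + S * (a * a ^ m)) + x * (S * (a * a ^ m)) * S"
    by (simp add: IH[symmetric] a(2) mult_ac)
  also have "\<dots> = 1 + x * (T + S * (a * a ^ m) * (1 + S))"
    by (simp add: algebra_simps)
  also have "\<dots> = 1 + x * (T + S * (a * (a * a ^ m)) + S * (a * (a * a ^ m)))"
    by (simp add: algebra_simps flip: a(1))
  finally show ?case by (simp add: T_def add.assoc)
qed

text \<open>Induction on the relative depth for all positive labels at once; positivity keeps the
  subtraction in \<open>h + k - 2\<close> exact.\<close>

lemma num_descendants_NewSch:
  fixes a :: "real fps"
  defines "S \<equiv> large_Schroeder_gf" and "a \<equiv> fps_const (1 / 2) * (1 + large_Schroeder_gf)"
  assumes "h \<ge> 1" "k \<ge> 1"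
  shows "real (num_descendants NewSch n (h, k)) = (S * a ^ (h + k - 2)) $ n"
  using assms(3,4)
proof (induction n arbitrary: h k)
  case 0
  have "S $ 0 = (1 + fps_X * S + fps_X * S ^ 2) $ 0"
    unfolding S_def using large_Schroeder_gf_eq by simp
  then have "S $ 0 = 1" by simp
  moreover from this have "a $ 0 = 1" by (simp add: a_def S_def)
  ultimately show ?case by (simp add: fps_power_zeroth)
next
  case (Suc n)
  define m where "m = h + k - 2"
  let ?g = "\<lambda>j. (S * a ^ j) $ n"
  have two: "2 * a = 1 + S"
    unfolding a_def S_def
    by (simp add: fps_numeral_fps_const flip: mult.assoc)
  have eq: "S = 1 + fps_X * S + fps_X * S ^ 2"
    unfolding S_def by (rule large_Schroeder_gf_eq)
  \<comment> \<open>Both sides equal \<open>S - 1 = fps_X * S * (1 + S)\<close>.\<close>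
  have "2 * (a - 1) = 2 * (fps_X * S * a)" using two eq by algebra
  then have am1: "a - 1 = fps_X * S * a" by (subst (asm) mult_left_cancel) simp_all
  have "real (num_descendants NewSch (Suc n) (h, k)) =
     (\<Sum>i\<in>{1..<h + 1}. real (num_descendants NewSch n (i, k + 1))) +
     (\<Sum>j\<in>{1..<k}. real (num_descendants NewSch n (2, j))) +
     real (num_descendants NewSch n (h + 1, k))"
    by (simp add: NewSch_def comp_def sum_list_distinct_conv_sum_set del: upt_Suc)
  also have "\<dots> = (\<Sum>i\<in>{1..<h + 1}. ?g (i + (k + 1) - 2)) + (\<Sum>j\<in>{1..<k}. ?g (2 + j - 2))
      + ?g (h + 1 + k - 2)"
    using Suc.prems by (simp add: Suc.IH)
  \<comment> \<open>The children \<open>(i, k + 1)\<close> yield the exponents from \<open>k\<close>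
    to \<open>h + k - 1\<close>; the children \<open>(2, j)\<close> then fill the gap from
    \<open>1\<close> to \<open>k - 1\<close>.\<close>
  also have "(\<Sum>i\<in>{1..<h + 1}. ?g (i + (k + 1) - 2)) = (\<Sum>j\<in>{k..<h + k}. ?g j)"
    by (rule sum.reindex_bij_witness[of _ "\<lambda>j. j + 1 - k" "\<lambda>i. i + k - 1"])
      (use Suc.prems in auto)
  also have "(\<Sum>j\<in>{k..<h + k}. ?g j) + (\<Sum>j\<in>{1..<k}. ?g (2 + j - 2)) = (\<Sum>j\<in>{1..<h + k}. ?g j)"
    using Suc.prems sum.atLeastLessThan_concat[of 1 k "h + k" ?g] by simp
  also have "{1..<h + k} = {1..m + 1}" using Suc.prems by (auto simp: m_def)
  also have "h + 1 + k - 2 = m + 1" using Suc.prems by (simp add: m_def)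
  \<comment> \<open>The factor \<open>fps_X\<close> shifts coefficient \<open>n\<close> to
    \<open>Suc n\<close>, where the summand \<open>1\<close> contributes nothing.\<close>
  also have "(\<Sum>j=1..m + 1. ?g j) + ?g (m + 1) =
      (1 + fps_X * ((\<Sum>i=1..m + 1. S * a ^ i) + S * a ^ (m + 1))) $ Suc n"
    by (simp add: fps_sum_nth del: sum.cl_ivl_Suc)
  also have "\<dots> = (S * a ^ m) $ Suc n"
    by (simp only: sum_telescope_Schroeder[OF eq two am1, symmetric])
  finally show ?case by (simp add: m_def)
qed

theorem theorem3:
  fixes c :: "nat \<Rightarrow> nat"
  defines "c \<equiv> enumeration_seq NewSch"
  shows "Abs_fps (\<lambda>n. real (c (n + 1))) = large_Schroeder_gf
    \<and> c 1 = 1 \<and> c 2 = 2 \<and> c 3 = 6 \<and> c 4 = 22 \<and> c 5 = 90"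
proof -
  have c: "c (Suc n) = num_descendants NewSch n (1, 1)" for n
    by (simp add: c_def enumeration_seq_Suc) (simp add: NewSch_def)
  have "Abs_fps (\<lambda>n. real (c (n + 1))) = large_Schroeder_gf"
    by (rule fps_ext) (simp add: c num_descendants_NewSch)
  \<comment> \<open>The first values come from evaluating the recursion at \<open>(1, 1)\<close>,
    not from the series.\<close>
  moreover have "c (Suc 0) = 1" "c (Suc (Suc 0)) = 2" "c (Suc (Suc (Suc 0))) = 6"
    "c (Suc (Suc (Suc (Suc 0)))) = 22" "c (Suc (Suc (Suc (Suc (Suc 0))))) = 90"
    unfolding c by (simp_all add: NewSch_def upt_rec)
  ultimately show ?thesis by (simp add: eval_nat_numeral)
qed

end
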